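(* Let $S=\langle n_1,\ldots,n_k\rangle$ be a numerical monoid with minimal generators $n_1<n_2<\cdots<n_k$, $k\ge 2$, and set $$N_0=\frac{F(S)+n_2}{n_2/n_1-1}.$$ Let $n\in\mathbb Z$ with $n>N_0$. Then every maximal bullet $\mathbf b\in\operatorname{bul}(n)$ satisfies $b_1>0$, and $\omega(n)=\omega(n-n_1)+1$.
   Context: A numerical monoid is $S=\langle n_1,\ldots,n_k\rangle=\{c_1n_1+\cdots+c_kn_k: c_i\in\mathbb N\}\subset\mathbb N$ with $n_1,\ldots,n_k$ relatively prime positive integers ($\gcd(n_1,\ldots,n_k)=1$), where $\mathbb N$ includes $0$; the quotient group of $S$ is $\mathbb Z$. The generators $n_1,\ldots,n_k$ are assumed to be the (unique) minimal generating set. $F(S)=\max(\mathbb N\setminus S)$ is the Frobenius number. For $n\in\mathbb Z$, a bullet for $n$ is a tuple $\mathbf b\in\mathbb N^k$ such that (i) $\sum_j b_jn_j-n\in S$, and (ii) $\sum_j b_jn_j-n-n_i\notin S$ for each $i$ with $b_i>0$. The set of bullets is $\operatorname{bul}(n)$, and the length of $\mathbf b$ is $|\mathbf b|=\sum_j b_j$. A bullet in $\operatorname{bul}(n)$ is maximal if its length is maximal among all bullets for $n$. For $n\in\mathbb Z$, $\omega(n)$ is the smallest nonnegative integer $m$ such that whenever $\sum_{i=1}^r a_i-n\in S$ with $r>m$ and $a_i\in S$, there is $T\subset\{1,\ldots,r\}$ with $|T|\le m$ and $\sum_{i\in T}a_i-n\in S$ ($\omega(n)=\infty$ if no such $m$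 exists). *)

theory Defs
  imports Complex_Main "HOL-Library.FuncSet" "HOL-Library.Extended_Nat"
begin

text \<open>
  Generators are given as a function \<open>n\<close> on an index set. Monoids are sets of integers, since
  differences \<open>a - z\<close> with integer \<open>z\<close> are tested for membership; all their elements are
  nonnegative.
\<close>

definition gen_monoid :: "(nat \<Rightarrow> nat) \<Rightarrow> nat set \<Rightarrow> int set" where
  "gen_monoid n I = {s. \<exists>c :: nat \<Rightarrow> nat. s = (\<Sum>i\<in>I. int (c i) * int (n i))}"

definition minimal_generators :: "(nat \<Rightarrow> nat) \<Rightarrow> nat set \<Rightarrow> bool" where
  "minimal_generators n I \<longleftrightarrow> (\<forall>J. J \<subset> I \<longrightarrow> gen_monoid n J \<noteq> gen_monoid n I)"

text \<open>
  The maximum exists for a numerical monoid other than the monoid of all nonnegative integers;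
  that monoid is minimally generated by \<open>1\<close> alone.
\<close>

definition frobenius_number :: "int set \<Rightarrow> int" where
  "frobenius_number S = Max ({0..} - S)"

text \<open>
  A tuple in \<open>\<nat>\<^sup>k\<close> is an extensional function on \<open>{1..k}\<close>.
\<close>

definition bullets :: "nat \<Rightarrow> (nat \<Rightarrow> nat) \<Rightarrow> int \<Rightarrow> (nat \<Rightarrow> nat) set" where
  "bullets k n z = {b \<in> {1..k} \<rightarrow>\<^sub>E (UNIV :: nat set).
     (\<Sum>j\<in>{1..k}. int (b j) * int (n j)) - z \<in> gen_monoid n {1..k} \<and>
     (\<forall>i\<in>{1..k}. b i > 0 \<longrightarrow>
        (\<Sum>j\<in>{1..k}. int (b j) * int (n j)) - z - int (n i) \<notin> gen_monoid n {1..k})}"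

definition bullet_length :: "nat \<Rightarrow> (nat \<Rightarrow> nat) \<Rightarrow> nat" where
  "bullet_length k b = (\<Sum>j\<in>{1..k}. b j)"

definition maximal_bullet :: "nat \<Rightarrow> (nat \<Rightarrow> nat) \<Rightarrow> int \<Rightarrow> (nat \<Rightarrow> nat) \<Rightarrow> bool" where
  "maximal_bullet k n z b \<longleftrightarrow>
     b \<in> bullets k n z \<and> (\<forall>b'\<in>bullets k n z. bullet_length k b' \<le> bullet_length k b)"

definition omega_bound :: "int set \<Rightarrow> int \<Rightarrow> nat \<Rightarrow> bool" where
  "omega_bound S z m \<longleftrightarrow>
     (\<forall>(r :: nat) (a :: nat \<Rightarrow> int).
        r > m \<and> (\<forall>i\<in>{1..r}. a i \<in> S) \<and> (\<Sum>i\<in>{1..r}. a i) - z \<in> S \<longrightarrow>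
        (\<exists>T\<subseteq>{1..r}. card T \<le> m \<and> (\<Sum>i\<in>T. a i) - z \<in> S))"

definition omega :: "int set \<Rightarrow> int \<Rightarrow> enat" where
  "omega S z = (if \<exists>m. omega_bound S z m then enat (LEAST m. omega_bound S z m) else \<infinity>)"

end

theory Submission
  imports Defs
begin

text \<open>
  For every integer \<open>z\<close>, \<open>\<omega>(z)\<close> is the maximal length of a bullet for \<open>z\<close>
  (\<open>omega_eq_maximal_bullet_length\<close>): a bullet, read as a family of generators, cannot lose any
  member, and conversely every family summing into \<open>z + S\<close> has a subfamily, no larger than a
  suitable bullet, that still does (\<open>small_subfamily_covering\<close>).

  Now let \<open>b\<close> be a bullet for \<open>z > 0\<close> with \<open>b\<^sub>1 = 0\<close>. Dropping one generator from it leaves a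
  difference outside \<open>S\<close>, so the remaining \<open>|b| - 1\<close> generators, each at least \<open>n\<^sub>2\<close>, have sum at
  most \<open>z + F(S)\<close>. Hence \<open>|b| \<le> (z + F(S) + n\<^sub>2) / n\<^sub>2\<close>. On the other hand some multiple
  \<open>c e\<^sub>1\<close> of the first unit vector is a bullet, and \<open>c \<ge> z / n\<^sub>1\<close>. The condition \<open>z > N\<^sub>0\<close> is a
  rearrangement of \<open>(z + F(S) + n\<^sub>2) / n\<^sub>2 < z / n\<^sub>1\<close>, so \<open>b\<close> is shorter than \<open>c e\<^sub>1\<close>, hence not
  maximal.

  For the recursion (\<open>omega_shift\<close>), subtracting \<open>e\<^sub>1\<close> from a maximal bullet for \<open>z\<close> gives a
  bullet for \<open>z - n\<^sub>1\<close>. In the other direction, adding \<open>e\<^sub>1\<close> to a bullet \<open>d\<close> for \<open>z - n\<^sub>1\<close> gives a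
  bullet for \<open>z\<close>, unless \<open>d\<close> is already a bullet for \<open>z\<close>. In that case \<open>d\<^sub>1 = 0\<close>, so some
  bullet for \<open>z\<close> is strictly longer than \<open>d\<close>. Both cases give \<open>|d| + 1 \<le> \<omega>(z)\<close>.
\<close>

section \<open>Monoids generated by natural numbers\<close>

lemma gen_monoid_add:
  assumes "x \<in> gen_monoid n I" "y \<in> gen_monoid n I"
  shows "x + y \<in> gen_monoid n I"
proof -
  obtain c d where "x = (\<Sum>i\<in>I. int (c i) * int (n i))" "y = (\<Sum>i\<in>I. int (d i) * int (n i))"
    using assms unfolding gen_monoid_def by blast
  then have "x + y = (\<Sum>i\<in>I. int (c i + d i) * int (n i))"
    by (simp add: sum.distrib distrib_right)
  then show ?thesis
    unfolding gen_monoid_def by (intro CollectI exI[of _ "\<lambda>i. c i + d i"])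
qed

lemma gen_monoid_combination: "(\<Sum>i\<in>I. int (c i) * int (n i)) \<in> gen_monoid n I"
  unfolding gen_monoid_def by blast

lemma gen_monoid_multiple:
  assumes "finite I" "i \<in> I"
  shows "int q * int (n i) \<in> gen_monoid n I"
proof -
  have "(\<Sum>j\<in>I. int (if j = i then q else 0) * int (n j))
      = (\<Sum>j\<in>I. if j = i then int q * int (n j) else 0)"
    by (rule sum.cong) auto
  also have "\<dots> = int q * int (n i)"
    using assms by simp
  finally show ?thesis
    using gen_monoid_combination by metis
qed

lemma gen_monoid_generator:
  assumes "finite I" "i \<in> I"
  shows "int (n i) \<in> gen_monoid n I"
  using gen_monoid_multiple[OF assms, of 1] by simp

lemma gen_monoid_zero: "0 \<in> gen_monoid n I"
  using gen_monoid_combination[where c = "\<lambda>_. 0"] by simp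

lemma gen_monoid_nonneg: "x \<in> gen_monoid n I \<Longrightarrow> 0 \<le> x"
  unfolding gen_monoid_def by (auto intro!: sum_nonneg)

lemma gen_monoid_sum:
  assumes "finite T" "\<And>i. i \<in> T \<Longrightarrow> a i \<in> gen_monoid n I"
  shows "(\<Sum>i\<in>T. a i) \<in> gen_monoid n I"
  using assms by (induction T rule: finite_induct) (auto intro: gen_monoid_zero gen_monoid_add)

lemma Gcd_eq_int_combination:
  fixes n :: "'a \<Rightarrow> nat"
  assumes "finite I"
  shows "\<exists>u :: 'a \<Rightarrow> int. (\<Sum>i\<in>I. u i * int (n i)) = int (Gcd (n ` I))"
  using assms
proof (induction I rule: finite_induct)
  case empty
  then show ?case by simp
next
  case (insert x I)
  then obtain u where u: "(\<Sum>i\<in>I. u i * int (n i)) = int (Gcd (n ` I))"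
    by blast
  obtain p q where "p * int (n x) + q * int (Gcd (n ` I)) = gcd (int (n x)) (int (Gcd (n ` I)))"
    using bezout_int by blast
  then have *: "p * int (n x) + q * (\<Sum>i\<in>I. u i * int (n i)) = int (Gcd (n ` insert x I))"
    using u by simp
  have "(\<Sum>i\<in>I. (if i = x then p else q * u i) * int (n i)) = (\<Sum>i\<in>I. q * (u i * int (n i)))"
    using insert.hyps by (intro sum.cong) auto
  then have "(\<Sum>i\<in>insert x I. (if i = x then p else q * u i) * int (n i))
      = int (Gcd (n ` insert x I))"
    using insert.hyps * by (simp add: sum_distrib_left)
  then show ?case by (intro exI[of _ "\<lambda>i. if i = x then p else q * u i"])
qed

text \<open>
  A Bezout relation \<open>\<Sum> u\<^sub>i n\<^sub>i = 1\<close>, multiplied by \<open>x\<close>, represents \<open>x\<close> with integer coefficients.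
  Reducing these modulo one generator \<open>N\<close> makes them nonnegative and bounded, and changes the
  represented number by a multiple of \<open>N\<close>; for large \<open>x\<close> that multiple is nonnegative.
\<close>

lemma gen_monoid_cofinite:
  assumes "finite I" "i0 \<in> I" "n i0 > 0" "Gcd (n ` I) = 1"
  shows "\<exists>B. \<forall>x\<ge>B. x \<in> gen_monoid n I"
proof (intro exI allI impI)
  fix x :: int
  assume x: "int (n i0) * (\<Sum>i\<in>I. int (n i)) \<le> x"
  obtain u where u: "(\<Sum>i\<in>I. u i * int (n i)) = 1"
    using Gcd_eq_int_combination[OF assms(1), of n] assms(4) by auto
  define N where "N = int (n i0)"
  have N: "N > 0" using assms(3) by (simp add: N_def)
  define c where "c i = nat ((x * u i) mod N)" for i
  have c: "int (c i) = (x * u i) mod N" for i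
    using N by (simp add: c_def)
  define s where "s = (\<Sum>i\<in>I. int (c i) * int (n i))"
  have "s \<le> (\<Sum>i\<in>I. N * int (n i))"
    unfolding s_def c using N by (intro sum_mono mult_right_mono) (auto intro: less_imp_le)
  also have "\<dots> \<le> x"
    using x by (simp add: N_def sum_distrib_left)
  finally have "s \<le> x" .
  have "x - s = x * (\<Sum>i\<in>I. u i * int (n i)) - s"
    by (simp add: u)
  also have "\<dots> = (\<Sum>i\<in>I. (x * u i - (x * u i) mod N) * int (n i))"
    unfolding s_def c by (simp add: sum_distrib_left sum_subtractf left_diff_distrib mult.assoc)
  also have "\<dots> = N * (\<Sum>i\<in>I. (x * u i) div N * int (n i))"
    by (simp add: minus_mod_eq_mult_div sum_distrib_left mult.assoc)
  finally have q: "x - s = N * (\<Sum>i\<in>I. (x * u i) div N * int (n i))" (is "_ = N * ?q") .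
  have "0 \<le> ?q"
    using \<open>s \<le> x\<close> q N by (metis diff_ge_0_iff_ge zero_le_mult_iff not_less)
  then have "x = s + int (nat ?q) * int (n i0)"
    using q by (simp add: N_def algebra_simps)
  then show "x \<in> gen_monoid n I"
    using gen_monoid_add[OF gen_monoid_combination gen_monoid_multiple[OF assms(1,2)]]
    unfolding s_def by metis
qed

text \<open>
  Read \<open>b j\<close> as the demand for goods of kind \<open>j\<close> and \<open>c i j\<close> as what supplier \<open>i\<close> offers. Each
  unit of demand can be charged to one supplier, so no more suppliers are needed than the total
  demand: a supplier that lowers no demand is dropped, and any other lowers the total by at least
  one.
\<close>

lemma small_subfamily_covering:
  fixes b :: "'j \<Rightarrow> nat" and c :: "'i \<Rightarrow> 'j \<Rightarrow> nat"
  assumes "finite J" "finite T" "\<And>j. j \<in> J \<Longrightarrow> b j \<le> (\<Sum>i\<in>T. c i j)"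
  shows "\<exists>T'\<subseteq>T. card T' \<le> (\<Sum>j\<in>J. b j) \<and> (\<forall>j\<in>J. b j \<le> (\<Sum>i\<in>T'. c i j))"
  using assms(2,3)
proof (induction T arbitrary: b rule: finite_induct)
  case empty
  then show ?case by auto
next
  case (insert x T)
  have "b j - c x j \<le> (\<Sum>i\<in>T. c i j)" if "j \<in> J" for j
    using insert.prems[OF that] insert.hyps by simp
  from insert.IH[OF this] obtain T' where T': "T' \<subseteq> T"
    "card T' \<le> (\<Sum>j\<in>J. b j - c x j)" "\<forall>j\<in>J. b j - c x j \<le> (\<Sum>i\<in>T'. c i j)"
    by blast
  have fin: "finite T'" "x \<notin> T'"
    using T'(1) insert.hyps finite_subset by auto
  show ?case
  proof (cases "\<exists>j\<in>J. b j - c x j < b j")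
    case True
    then have "(\<Sum>j\<in>J. b j - c x j) < (\<Sum>j\<in>J. b j)"
      using assms(1) by (intro sum_strict_mono_ex1) auto
    moreover have "b j \<le> (\<Sum>i\<in>insert x T'. c i j)" if "j \<in> J" for j
      using T'(3) that fin by fastforce
    ultimately show ?thesis
      using T' fin by (intro exI[of _ "insert x T'"]) auto
  next
    case False
    then have eq: "b j - c x j = b j" if "j \<in> J" for j
      using that by (meson diff_le_self le_neq_implies_less)
    have "(\<Sum>j\<in>J. b j - c x j) = (\<Sum>j\<in>J. b j)"
      using eq by (intro sum.cong) auto
    then show ?thesis
      using T' eq by (intro exI[of _ T']) auto
  qed
qed

section \<open>Bullets and omega\<close>

locale numerical_monoid =
  fixes k :: nat and n :: "nat \<Rightarrow> nat"
  assumes k_pos: "1 \<le> k"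
    and n_pos: "i \<in> {1..k} \<Longrightarrow> 0 < n i"
    and Gcd_n: "Gcd (n ` {1..k}) = 1"
begin

abbreviation monoid :: "int set" where
  "monoid \<equiv> gen_monoid n {1..k}"

definition weight :: "(nat \<Rightarrow> nat) \<Rightarrow> int" where
  "weight b = (\<Sum>j\<in>{1..k}. int (b j) * int (n j))"

lemma monoid_eq_range_weight: "monoid = range weight"
  unfolding gen_monoid_def weight_def by auto

lemma weight_restrict: "weight (restrict b {1..k}) = weight b"
  unfolding weight_def by (intro sum.cong) auto

lemma bullets_iff:
  "b \<in> bullets k n z \<longleftrightarrow> b \<in> extensional {1..k} \<and> weight b - z \<in> monoid \<and>
    (\<forall>i\<in>{1..k}. 0 < b i \<longrightarrow> weight b - z - int (n i) \<notin> monoid)"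
  unfolding bullets_def weight_def by (auto simp: PiE_def)

lemma bullet_weight_in: "b \<in> bullets k n z \<Longrightarrow> weight b - z \<in> monoid"
  by (simp add: bullets_iff)

lemma bullet_remove_notin:
  "b \<in> bullets k n z \<Longrightarrow> i \<in> {1..k} \<Longrightarrow> 0 < b i \<Longrightarrow> weight b - z - int (n i) \<notin> monoid"
  by (simp add: bullets_iff)

lemma weight_update:
  assumes "i \<in> {1..k}"
  shows "weight (b(i := m)) = weight b + (int m - int (b i)) * int (n i)"
proof -
  have "weight b = int (b i) * int (n i) + (\<Sum>j\<in>{1..k} - {i}. int (b j) * int (n j))" for b
    unfolding weight_def using assms by (intro sum.remove) auto
  from this[of b] this[of "b(i := m)"] show ?thesis
    by (simp add: algebra_simps)
qed

lemma bullet_length_update: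
  assumes "i \<in> {1..k}"
  shows "bullet_length k (b(i := m)) + b i = bullet_length k b + m"
proof -
  have "bullet_length k b = b i + (\<Sum>j\<in>{1..k} - {i}. b j)" for b
    unfolding bullet_length_def using assms by (intro sum.remove) auto
  from this[of b] this[of "b(i := m)"] show ?thesis
    by simp
qed

text \<open>
  Generators can be dropped from a coefficient vector one at a time, as long as the difference
  with \<open>z\<close> stays in the monoid; where this stops, a bullet is reached.
\<close>

lemma bullet_below:
  assumes "weight c - z \<in> monoid"
  shows "\<exists>b \<in> bullets k n z. \<forall>j\<in>{1..k}. b j \<le> c j"
  using assms
proof (induction "bullet_length k c" arbitrary: c rule: less_induct)
  case less
  show ?case
  proof (cases "\<exists>i\<in>{1..k}. 0 < c i \<and> weight c - z - int (n i) \<in> monoid")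
    case True
    then obtain i where i: "i \<in> {1..k}" "0 < c i" "weight c - z - int (n i) \<in> monoid"
      by blast
    let ?c = "c(i := c i - 1)"
    have "weight ?c - z = weight c - z - int (n i)"
      using i(2) weight_update[OF i(1), of c "c i - 1"] by (simp add: of_nat_diff)
    then have "weight ?c - z \<in> monoid"
      using i(3) by metis
    moreover have "bullet_length k ?c < bullet_length k c"
      using i(2) bullet_length_update[OF i(1), of c "c i - 1"] by simp
    ultimately obtain b where b: "b \<in> bullets k n z" "\<forall>j\<in>{1..k}. b j \<le> ?c j"
      using less.hyps by blast
    have "?c j \<le> c j" for j by simp
    then show ?thesis
      using b order_trans by blast
  next
    case False
    then have "restrict c {1..k} \<in> bullets k n z"
      using less.prems unfolding bullets_iff weight_restrict by auto
    then show ?thesis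
      by (intro bexI[of _ "restrict c {1..k}"]) auto
  qed
qed

text \<open>
  Dropping one generator from a nonzero bullet leaves a difference below \<open>B\<close>, which bounds the
  number of the remaining generators, all at least \<open>1\<close>.
\<close>

lemma bullet_length_bound:
  assumes "b \<in> bullets k n z" "\<forall>x\<ge>B. x \<in> monoid"
  shows "int (bullet_length k b) \<le> max 0 (z + B)"
proof (cases "\<exists>i\<in>{1..k}. 0 < b i")
  case True
  then obtain i where i: "i \<in> {1..k}" "0 < b i" by blast
  have "weight b - z - int (n i) < B"
    using bullet_remove_notin[OF assms(1) i] assms(2) by (meson not_less)
  moreover have "int (bullet_length k (b(i := b i - 1))) \<le> weight (b(i := b i - 1))"
    unfolding bullet_length_def weight_def of_nat_sum
  proof (rule sum_mono)
    fix j assume "j \<in> {1..k}"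
    then have "1 \<le> int (n j)" using n_pos by fastforce
    then show "int ((b(i := b i - 1)) j) \<le> int ((b(i := b i - 1)) j) * int (n j)"
      by (simp add: mult_le_cancel_left1)
  qed
  moreover have "weight (b(i := b i - 1)) = weight b - int (n i)"
    using i weight_update[OF i(1), of b "b i - 1"] by (simp add: of_nat_diff)
  moreover have "bullet_length k b = bullet_length k (b(i := b i - 1)) + 1"
    using i(2) bullet_length_update[OF i(1), of b "b i - 1"] by simp
  ultimately show ?thesis by linarith
next
  case False
  then have "bullet_length k b = 0" by (simp add: bullet_length_def)
  then show ?thesis by simp
qed

lemma eventually_in_monoid: "\<exists>B. \<forall>x\<ge>B. x \<in> monoid"
  using gen_monoid_cofinite[of "{1..k}" 1 n] k_pos n_pos Gcd_n by simp

text \<open>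
  Take the least \<open>c\<close> for which \<open>c n\<^sub>1\<close> exceeds \<open>z\<close> by an element of the monoid.
\<close>

lemma bullet_first_generator:
  "\<exists>c. (\<lambda>j\<in>{1..k}. if j = 1 then c else 0) \<in> bullets k n z \<and> z \<le> int c * int (n 1)"
proof -
  have w: "weight (\<lambda>j\<in>{1..k}. if j = 1 then c else 0) = int c * int (n 1)" for c
  proof -
    have "weight (\<lambda>j\<in>{1..k}. if j = 1 then c else 0)
        = (\<Sum>j\<in>{1..k}. if j = 1 then int c * int (n j) else 0)"
      unfolding weight_def by (intro sum.cong) auto
    then show ?thesis using k_pos by simp
  qed
  define P where "P c \<longleftrightarrow> int c * int (n 1) - z \<in> monoid" for c
  obtain B where B: "\<forall>x\<ge>B. x \<in> monoid"
    using eventually_in_monoid by blast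
  have "1 \<le> int (n 1)" using n_pos[of 1] k_pos by simp
  then have "int (nat (B + z)) * 1 \<le> int (nat (B + z)) * int (n 1)"
    by (intro mult_left_mono) auto
  then have "P (nat (B + z))"
    unfolding P_def using B by auto
  then have PL: "P (LEAST c. P c)" (is "P ?c") by (rule LeastI)
  then have le: "0 \<le> int ?c * int (n 1) - z"
    unfolding P_def[of ?c] by (rule gen_monoid_nonneg)
  have "int ?c * int (n 1) - z - int (n 1) \<notin> monoid" if "0 < ?c"
  proof -
    have "\<not> P (?c - 1)" using that by (intro not_less_Least) simp
    then show ?thesis using that by (simp add: P_def of_nat_diff algebra_simps)
  qed
  then have "(\<lambda>j\<in>{1..k}. if j = 1 then ?c else 0) \<in> bullets k n z"
    using PL unfolding bullets_iff w P_def by (auto split: if_splits)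
  moreover have "z \<le> int ?c * int (n 1)"
    using le by simp
  ultimately show ?thesis by blast
qed

lemma bullet_length_first_generator:
  "bullet_length k (\<lambda>j\<in>{1..k}. if j = 1 then c else 0) = c"
proof -
  have "bullet_length k (\<lambda>j\<in>{1..k}. if j = 1 then c else 0) = (\<Sum>j\<in>{1..k}. if j = 1 then c else 0)"
    unfolding bullet_length_def by (intro sum.cong) auto
  then show ?thesis using k_pos by simp
qed

lemma maximal_bullet_exists: "\<exists>b. maximal_bullet k n z b"
proof -
  obtain B where B: "\<forall>x\<ge>B. x \<in> monoid"
    using eventually_in_monoid by blast
  obtain b0 where b0: "b0 \<in> bullets k n z"
    using bullet_first_generator by blast
  have "\<forall>b. b \<in> bullets k n z \<longrightarrow> bullet_length k b \<le> nat (max 0 (z + B))"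
    using bullet_length_bound[OF _ B] by (auto simp: le_nat_iff)
  then show ?thesis
    using ex_has_greatest_nat[of "\<lambda>b. b \<in> bullets k n z" b0 "bullet_length k"
        "Suc (nat (max 0 (z + B)))"] b0
    unfolding maximal_bullet_def by (auto simp: less_Suc_eq_le)
qed

text \<open>
  Writing a sum of monoid elements in terms of generators and shrinking the coefficient vector to
  a bullet \<open>b\<close>, at most \<open>|b|\<close> of the summands are needed to cover \<open>b\<close>.
\<close>

lemma omega_bound_of_bullets:
  assumes "\<And>b. b \<in> bullets k n z \<Longrightarrow> bullet_length k b \<le> m"
  shows "omega_bound monoid z m"
  unfolding omega_bound_def
proof (intro allI impI)
  fix r :: nat and a :: "nat \<Rightarrow> int"
  assume a: "m < r \<and> (\<forall>i\<in>{1..r}. a i \<in> monoid) \<and> (\<Sum>i\<in>{1..r}. a i) - z \<in> monoid"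
  then have "\<forall>i\<in>{1..r}. \<exists>c. a i = weight c"
    unfolding monoid_eq_range_weight by blast
  then obtain c where c: "\<And>i. i \<in> {1..r} \<Longrightarrow> a i = weight (c i)"
    by metis
  have sum_a: "(\<Sum>i\<in>T. a i) = weight (\<lambda>j. \<Sum>i\<in>T. c i j)" if "T \<subseteq> {1..r}" for T
  proof -
    have "(\<Sum>i\<in>T. a i) = (\<Sum>i\<in>T. weight (c i))"
      using that c by (intro sum.cong) auto
    also have "\<dots> = weight (\<lambda>j. \<Sum>i\<in>T. c i j)"
      unfolding weight_def by (subst sum.swap) (simp add: sum_distrib_right)
    finally show ?thesis .
  qed
  have "weight (\<lambda>j. \<Sum>i\<in>{1..r}. c i j) - z \<in> monoid"
    using a sum_a[of "{1..r}"] by simp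
  then obtain b where b: "b \<in> bullets k n z" "\<forall>j\<in>{1..k}. b j \<le> (\<Sum>i\<in>{1..r}. c i j)"
    using bullet_below[of "\<lambda>j. \<Sum>i\<in>{1..r}. c i j"] by blast
  then obtain T where T: "T \<subseteq> {1..r}" "card T \<le> bullet_length k b"
    "\<forall>j\<in>{1..k}. b j \<le> (\<Sum>i\<in>T. c i j)"
    using small_subfamily_covering[of "{1..k}" "{1..r}" b c] unfolding bullet_length_def by auto
  have "weight (\<lambda>j. \<Sum>i\<in>T. c i j) = weight b + weight (\<lambda>j. (\<Sum>i\<in>T. c i j) - b j)"
    using T(3) unfolding weight_def sum.distrib[symmetric]
    by (intro sum.cong) (auto simp: of_nat_diff simp flip: distrib_right of_nat_add)
  then have "(\<Sum>i\<in>T. a i) - z = (weight b - z) + weight (\<lambda>j. (\<Sum>i\<in>T. c i j) - b j)"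
    using sum_a[OF T(1)] by simp
  then have "(\<Sum>i\<in>T. a i) - z \<in> monoid"
    using gen_monoid_add[OF bullet_weight_in[OF b(1)], of "weight (\<lambda>j. (\<Sum>i\<in>T. c i j) - b j)"]
      monoid_eq_range_weight by (metis rangeI)
  then show "\<exists>T\<subseteq>{1..r}. card T \<le> m \<and> (\<Sum>i\<in>T. a i) - z \<in> monoid"
    using T assms[OF b(1)] by (meson order_trans)
qed

text \<open>
  The family that lists each generator \<open>n\<^sub>j\<close> with multiplicity \<open>b\<^sub>j\<close> loses the divisibility as soon
  as one member is dropped.
\<close>

lemma bullet_length_le_omega_bound:
  assumes b: "b \<in> bullets k n z" and m: "omega_bound monoid z m"
  shows "bullet_length k b \<le> m"
proof (rule ccontr)
  assume less: "\<not> bullet_length k b \<le> m"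
  define X where "X = (SIGMA j:{1..k}. {..<b j})"
  have "finite X" "card X = bullet_length k b"
    by (simp_all add: X_def bullet_length_def)
  then obtain h where h: "bij_betw h {1..bullet_length k b} X"
    using ex_bij_betw_nat_finite_1[of X] by auto
  define a where "a i = int (n (fst (h i)))" for i
  have gen: "fst (h i) \<in> {1..k} \<and> 0 < b (fst (h i))" if "i \<in> {1..bullet_length k b}" for i
  proof -
    have "h i \<in> X" using h that by (rule bij_betwE[rule_format])
    then show ?thesis by (auto simp: X_def)
  qed
  have a: "a i \<in> monoid" if "i \<in> {1..bullet_length k b}" for i
    unfolding a_def using gen[OF that] by (intro gen_monoid_generator) auto
  have "(\<Sum>i\<in>{1..bullet_length k b}. a i) = (\<Sum>p\<in>X. int (n (fst p)))"
    unfolding a_def by (rule sum.reindex_bij_betw[OF h])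
  also have "\<dots> = (\<Sum>j\<in>{1..k}. \<Sum>_\<in>{..<b j}. int (n j))"
    unfolding X_def by (subst sum.Sigma) (auto simp: case_prod_unfold)
  finally have sum_a: "(\<Sum>i\<in>{1..bullet_length k b}. a i) = weight b"
    by (simp add: weight_def)
  then obtain T where T: "T \<subseteq> {1..bullet_length k b}" "card T \<le> m" "(\<Sum>i\<in>T. a i) - z \<in> monoid"
    using m less a bullet_weight_in[OF b] unfolding omega_bound_def by (metis not_le)
  have "T \<noteq> {1..bullet_length k b}"
    using T(2) less by auto
  then obtain i where i: "i \<in> {1..bullet_length k b}" "i \<notin> T"
    using T(1) by blast
  let ?R = "{1..bullet_length k b} - {i}"
  have "(\<Sum>l\<in>?R. a l) = (\<Sum>l\<in>T. a l) + (\<Sum>l\<in>?R - T. a l)"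
    using T(1) i by (subst add.commute, intro sum.subset_diff) auto
  moreover have "(\<Sum>l\<in>?R - T. a l) \<in> monoid"
    using a by (intro gen_monoid_sum) auto
  ultimately have "(\<Sum>l\<in>?R. a l) - z \<in> monoid"
    using gen_monoid_add[OF T(3)] by (metis add_diff_eq add.commute)
  moreover have "(\<Sum>l\<in>?R. a l) = weight b - a i"
    using sum.remove[of "{1..bullet_length k b}" i a] i sum_a by simp
  then have "(\<Sum>l\<in>?R. a l) - z = weight b - z - int (n (fst (h i)))"
    by (simp add: a_def)
  ultimately have "weight b - z - int (n (fst (h i))) \<in> monoid"
    by metis
  then show False
    using bullet_remove_notin[OF b] gen[OF i(1)] by blast
qed

lemma omega_eq_maximal_bullet_length:
  assumes "maximal_bullet k n z b"
  shows "omega monoid z = enat (bullet_length k b)"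
proof -
  have bound: "omega_bound monoid z (bullet_length k b)"
    using assms omega_bound_of_bullets unfolding maximal_bullet_def by blast
  have "(LEAST m. omega_bound monoid z m) = bullet_length k b"
    using bound bullet_length_le_omega_bound assms unfolding maximal_bullet_def
    by (intro Least_equality) auto
  then show ?thesis
    using bound unfolding omega_def by auto
qed

section \<open>Shifting by the first generator\<close>

lemma bullet_decrease:
  assumes "b \<in> bullets k n z" "i \<in> {1..k}" "0 < b i"
  shows "b(i := b i - 1) \<in> bullets k n (z - int (n i))"
proof -
  have eq: "weight (b(i := b i - 1)) - (z - int (n i)) = weight b - z"
    using weight_update[OF assms(2), of b "b i - 1"] assms(3) by (simp add: of_nat_diff)
  show ?thesis
    using assms unfolding bullets_iff eq
    by (auto simp: extensional_def split: if_splits)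
qed

lemma bullet_increase:
  assumes "b \<in> bullets k n (z - int (n i))" "i \<in> {1..k}" "weight b - z \<notin> monoid"
  shows "b(i := b i + 1) \<in> bullets k n z"
proof -
  have eq: "weight (b(i := b i + 1)) - z = weight b - (z - int (n i))"
    using weight_update[OF assms(2), of b "b i + 1"] by simp
  have "weight b - (z - int (n i)) - int (n i) \<notin> monoid"
    using assms(3) by simp
  then show ?thesis
    using assms unfolding bullets_iff eq
    by (auto simp: extensional_def split: if_splits)
qed

text \<open>
  If a bullet \<open>b\<close> of \<open>z - n\<^sub>i\<close> still reaches \<open>z\<close>, it cannot use \<open>n\<^sub>i\<close>, since removing \<open>n\<^sub>i\<close> from it
  would be allowed; it is then itself a bullet of \<open>z\<close>.
\<close>

lemma shifted_bullet_unused: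
  assumes "b \<in> bullets k n (z - int (n i))" "i \<in> {1..k}" "weight b - z \<in> monoid"
  shows "b \<in> bullets k n z" "b i = 0"
proof -
  show "b i = 0"
    using bullet_remove_notin[OF assms(1,2)] assms(3) by fastforce
  have "weight b - z - int (n j) \<notin> monoid" if "j \<in> {1..k}" "0 < b j" for j
  proof
    assume "weight b - z - int (n j) \<in> monoid"
    from gen_monoid_add[OF this gen_monoid_generator[of "{1..k}" i]] assms(2)
    have "weight b - (z - int (n i)) - int (n j) \<in> monoid"
      by (simp add: algebra_simps)
    with bullet_remove_notin[OF assms(1) that] show False by blast
  qed
  then show "b \<in> bullets k n z"
    using assms unfolding bullets_iff by blast
qed

text \<open>
  The hypothesis serves twice. It forces a longest bullet for \<open>z\<close> to use \<open>n\<^sub>i\<close>, so that one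
  copy can be removed; and it finds a longer bullet for \<open>z\<close> when a longest bullet for \<open>z - n\<^sub>i\<close>
  is already a bullet for \<open>z\<close> and cannot be lengthened by \<open>n\<^sub>i\<close>.
\<close>

lemma omega_shift:
  assumes i: "i \<in> {1..k}"
    and longer: "\<And>b. b \<in> bullets k n z \<Longrightarrow> b i = 0 \<Longrightarrow>
      \<exists>b'\<in>bullets k n z. bullet_length k b < bullet_length k b'"
  shows "omega monoid z = omega monoid (z - int (n i)) + 1"
proof -
  obtain b where b: "maximal_bullet k n z b"
    using maximal_bullet_exists by blast
  obtain d where d: "maximal_bullet k n (z - int (n i)) d"
    using maximal_bullet_exists by blast
  have "0 < b i"
    using b longer unfolding maximal_bullet_def by (meson gr0I not_le)
  then have "bullet_length k b \<le> bullet_length k d + 1"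
    using bullet_decrease[OF _ i] b d bullet_length_update[OF i, of b "b i - 1"]
    unfolding maximal_bullet_def by fastforce
  moreover have "bullet_length k d + 1 \<le> bullet_length k b"
  proof (cases "weight d - z \<in> monoid")
    case True
    then have "d \<in> bullets k n z" "d i = 0"
      using shifted_bullet_unused[OF _ i] d unfolding maximal_bullet_def by blast+
    then show ?thesis
      using longer b unfolding maximal_bullet_def by fastforce
  next
    case False
    then have "d(i := d i + 1) \<in> bullets k n z"
      using bullet_increase[OF _ i] d unfolding maximal_bullet_def by blast
    then show ?thesis
      using b bullet_length_update[OF i, of d "d i + 1"]
      unfolding maximal_bullet_def by fastforce
  qed
  ultimately have "bullet_length k b = bullet_length k d + 1" by simp
  then show ?thesis
    using omega_eq_maximal_bullet_length[OF b] omega_eq_maximal_bullet_length[OF d]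
    by (simp add: one_enat_def)
qed

section \<open>Bullets avoiding the smallest generator\<close>

text \<open>
  Excluding \<open>1\<close> makes the set of gaps nonempty, so that its maximum is a genuine one. Being
  positive, it then also bounds the negative integers.
\<close>

lemma notin_monoid_le_frobenius_number:
  assumes "x \<notin> monoid" "1 \<notin> monoid"
  shows "x \<le> frobenius_number monoid"
    and "1 \<le> frobenius_number monoid"
proof -
  obtain B where B: "\<forall>x\<ge>B. x \<in> monoid"
    using eventually_in_monoid by blast
  have "{0..} - monoid \<subseteq> {0..B}"
    using B by (auto intro: ccontr simp: not_le less_imp_le)
  then have fin: "finite ({0..} - monoid)"
    using finite_subset by blast
  show F: "1 \<le> frobenius_number monoid"
    unfolding frobenius_number_def using fin assms(2) by (intro Max_ge) auto
  show "x \<le> frobenius_number monoid"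
  proof (cases "0 \<le> x")
    case True
    then show ?thesis
      unfolding frobenius_number_def using fin assms(1) by (intro Max_ge) auto
  next
    case False
    then show ?thesis using F by simp
  qed
qed

text \<open>
  As \<open>z > 0\<close>, the bullet is not zero; after one generator is dropped, the difference is outside
  the monoid, hence at most \<open>F(S)\<close>, and the remaining generators are all at least \<open>n\<^sub>2\<close>.
\<close>

lemma bullet_avoiding_first_short:
  assumes b: "b \<in> bullets k n z" and "b 1 = 0" and "0 < z" and "1 \<notin> monoid"
    and n2: "\<And>i. i \<in> {2..k} \<Longrightarrow> n 2 \<le> n i"
  shows "int (bullet_length k b) * int (n 2) \<le> z + frobenius_number monoid + int (n 2)"
proof -
  have "\<exists>i\<in>{1..k}. 0 < b i"
  proof (rule ccontr)
    assume "\<not> ?thesis"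
    then have "weight b = 0" by (simp add: weight_def)
    then show False
      using gen_monoid_nonneg[OF bullet_weight_in[OF b]] \<open>0 < z\<close> by simp
  qed
  then obtain i where i: "i \<in> {1..k}" "0 < b i" by blast
  have "weight b - z - int (n i) \<le> frobenius_number monoid"
    using bullet_remove_notin[OF b i] assms(4) by (rule notin_monoid_le_frobenius_number)
  moreover have "int (bullet_length k (b(i := b i - 1))) * int (n 2) \<le> weight (b(i := b i - 1))"
    unfolding bullet_length_def weight_def of_nat_sum sum_distrib_right
  proof (rule sum_mono)
    fix j assume j: "j \<in> {1..k}"
    show "int ((b(i := b i - 1)) j) * int (n 2) \<le> int ((b(i := b i - 1)) j) * int (n j)"
    proof (cases "j = 1")
      case True
      then show ?thesis using \<open>b 1 = 0\<close> i(2) by auto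
    next
      case False
      then show ?thesis using j n2[of j] by (intro mult_left_mono) auto
    qed
  qed
  moreover have "weight (b(i := b i - 1)) = weight b - int (n i)"
    using i weight_update[OF i(1), of b "b i - 1"] by (simp add: of_nat_diff)
  moreover have "bullet_length k b = bullet_length k (b(i := b i - 1)) + 1"
    using i(2) bullet_length_update[OF i(1), of b "b i - 1"] by simp
  ultimately show ?thesis by (simp add: distrib_right)
qed

text \<open>
  If \<open>1\<close> were in the monoid, it would be a generator, hence the first one, and would generate
  everything alone, against minimality.
\<close>

lemma one_notin_monoid:
  assumes "2 \<le> k" "strict_mono_on {1..k} n" "minimal_generators n {1..k}"
  shows "1 \<notin> monoid"
proof
  assume "1 \<in> monoid"
  then obtain c where c: "1 = weight c"
    unfolding monoid_eq_range_weight by blast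
  have "\<exists>i\<in>{1..k}. int (c i) * int (n i) \<noteq> 0"
  proof (rule ccontr)
    assume "\<not> ?thesis"
    then have "weight c = 0" unfolding weight_def by (intro sum.neutral) blast
    then show False using c by simp
  qed
  then obtain i where i: "i \<in> {1..k}" "int (c i) * int (n i) \<noteq> 0"
    by blast
  have "int (c i) * int (n i) \<le> 1"
    unfolding c weight_def using i by (intro member_le_sum) auto
  then have "c i * n i \<le> 1"
    by (metis of_nat_1 of_nat_le_iff of_nat_mult)
  with i have "n i = 1"
    by (cases "c i"; cases "n i") auto
  have "n 1 = 1"
  proof (cases "i = 1")
    case False
    then have "n 1 < n i"
      using i(1) assms(2) k_pos by (intro strict_mono_onD[of "{1..k}" n]) auto
    then show ?thesis using \<open>n i = 1\<close> n_pos[of 1] k_pos by simp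
  qed (use \<open>n i = 1\<close> in simp)
  have "gen_monoid n {1} = {0..}"
  proof
    show "{0..} \<subseteq> gen_monoid n {1}"
    proof
      fix x :: int assume "x \<in> {0..}"
      then show "x \<in> gen_monoid n {1}"
        using gen_monoid_multiple[of "{1}" 1 "nat x" n] \<open>n 1 = 1\<close> by simp
    qed
  qed (use gen_monoid_nonneg in auto)
  moreover have "monoid = {0..}"
  proof
    show "{0..} \<subseteq> monoid"
    proof
      fix x :: int assume "x \<in> {0..}"
      then show "x \<in> monoid"
        using gen_monoid_multiple[of "{1..k}" 1 "nat x" n] \<open>n 1 = 1\<close> k_pos by simp
    qed
  qed (use gen_monoid_nonneg in auto)
  moreover have "{1} \<subset> {1..k}"
  proof -
    have "2 \<in> {1..k} - {1}" using assms(1) by simp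
    moreover have "{1} \<subseteq> {1..k}" using k_pos by simp
    ultimately show ?thesis by blast
  qed
  ultimately show False
    using assms(3) unfolding minimal_generators_def by metis
qed

end

theorem theorem6p12:
  fixes k :: nat and n :: "nat \<Rightarrow> nat" and S :: "int set" and N0 :: real and z :: int
  assumes "k \<ge> 2"
    and "\<forall>i\<in>{1..k}. n i > 0"
    and "Gcd (n ` {1..k}) = 1"
    and "strict_mono_on {1..k} n"
    and "minimal_generators n {1..k}"
    and "S = gen_monoid n {1..k}"
    and "N0 = (real_of_int (frobenius_number S) + real (n 2)) / (real (n 2) / real (n 1) - 1)"
    and "real_of_int z > N0"
  shows "(\<forall>b. maximal_bullet k n z b \<longrightarrow> b 1 > 0) \<and>
         omega S z = omega S (z - int (n 1)) + 1"
proof -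
  interpret numerical_monoid k n
    using assms(1-3) by unfold_locales auto
  have one: "1 \<notin> monoid"
    using one_notin_monoid assms(1,4,5) by blast
  define F where "F = frobenius_number S"
  have F: "1 \<le> F"
    using notin_monoid_le_frobenius_number(2)[OF one one] assms(6) by (simp add: F_def)
  have n1: "0 < n 1"
    using n_pos[of 1] assms(1) by simp
  have n12: "n 1 < n 2"
    using assms(1,4) by (intro strict_mono_onD[of "{1..k}" n]) auto
  have n2: "n 2 \<le> n i" if "i \<in> {2..k}" for i
    using that assms(1,4) strict_mono_on_imp_mono_on[of "{1..k}" n]
    by (intro monotone_onD[of "{1..k}" "(\<le>)" "(\<le>)" n]) auto
  have ratio: "0 < real (n 2) / real (n 1) - 1"
    using n1 n12 by simp
  have "0 \<le> N0"
    unfolding assms(7) using F ratio by (intro divide_nonneg_pos) (auto simp: F_def)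
  then have z: "0 < z"
    using assms(8) by linarith
  have "real_of_int F + real (n 2) < real_of_int z * (real (n 2) / real (n 1) - 1)"
    using assms(8) ratio unfolding assms(7) F_def by (simp add: pos_divide_less_eq)
  then have "real_of_int (z + F + int (n 2)) * real (n 1) < real_of_int z * real (n 2)"
    using n1 by (simp add: field_simps)
  then have threshold: "(z + F + int (n 2)) * int (n 1) < z * int (n 2)"
    by (metis of_int_less_iff of_int_mult of_int_of_nat_eq)
  have longer: "\<exists>b'\<in>bullets k n z. bullet_length k b < bullet_length k b'"
    if b: "b \<in> bullets k n z" "b 1 = 0" for b
  proof -
    obtain c where c: "(\<lambda>j\<in>{1..k}. if j = 1 then c else 0) \<in> bullets k n z"
      "z \<le> int c * int (n 1)"
      using bullet_first_generator by blast
    have "int (bullet_length k b) * int (n 2) \<le> z + F + int (n 2)"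
      using bullet_avoiding_first_short[OF b z one n2] assms(6) by (simp add: F_def)
    then have "int (bullet_length k b) * int (n 2) * int (n 1) \<le> (z + F + int (n 2)) * int (n 1)"
      by (rule mult_right_mono) simp
    also note threshold
    also have "z * int (n 2) \<le> int c * int (n 1) * int (n 2)"
      using c(2) by (rule mult_right_mono) simp
    finally have "int (bullet_length k b) * (int (n 2) * int (n 1)) < int c * (int (n 2) * int (n 1))"
      by (simp add: mult_ac)
    then have "bullet_length k b < c"
      by (simp add: mult_less_cancel_right)
    then show ?thesis
      using c(1) bullet_length_first_generator[of c] by metis
  qed
  have "0 < b 1" if "maximal_bullet k n z b" for b
    using that longer unfolding maximal_bullet_def by (meson gr0I not_le)
  moreover have "omega S z = omega S (z - int (n 1)) + 1"
    using omega_shift[of 1 z] longer assms(1,6) by simp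
  ultimately show ?thesis by blast
qed

end
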